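(* At every point $(x,y)\in\mathbb R^2$ where all the functions involved are defined, $$1-\prod_{k=-\infty}^{\infty}\sinh^2\!\big(f^k_{\mathrm{Dil.S.E.Cat}(x)}\big)\Big|_{(x,0)}+\prod_{k=-\infty}^{\infty}\sinh^2\!\big(f^k_{\mathrm{Dil.S.E.Cat}(y)}\big)\Big|_{(0,y)}=2\sin^2\!\left(\frac{f_{\mathrm{SpacelikeScherkTower}}(x,y)}{2}\right).$$
   Context: The spacelike Scherk tower in Lorentz–Minkowski space is the graph of $$f_{\mathrm{SpacelikeScherkTower}}(x,y)=2\sin^{-1}\sqrt{\tfrac12\left(\cos^2\!\left(\tfrac x{\sqrt2}\right)+\sin^2\!\left(\tfrac y{\sqrt2}\right)\right)}.$$ The dilated spacelike elliptic catenoids are the graphs of, for $k\in\mathbb Z\setminus\{0\}$, $$f^k_{\mathrm{Dil.S.E.Cat}(x)}(x,y)=\sinh^{-1}\sqrt{\frac{(\frac x{\sqrt2}+k\pi)^2+(\frac y{\sqrt2})^2}{\pi^2k^2}},\qquad f^k_{\mathrm{Dil.S.E.Cat}(y)}(x,y)=\sinh^{-1}\sqrt{\frac{(\frac x{\sqrt2})^2+(\frac y{\sqrt2}+k\pi)^2}{\pi^2k^2}},$$ and, for $k=0$, $$f^0_{\mathrm{Dil.S.E.Cat}(x)}(x,y)=f^0_{\mathrm{Dil.S.E.Cat}(y)}(x,y)=\sinh^{-1}\sqrt{\left(\tfrac x{\sqrt2}\right)^2+\left(\tfrac y{\sqrt2}\right)^2}.$$ The infinite products are limits of the symmetric partial products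 $\prod_{|k|\le N}$ as $N\to\infty$. *)

theory Defs
  imports Complex_Main
begin

definition scherk_tower :: "real \<Rightarrow> real \<Rightarrow> real" where
  "scherk_tower x y =
     2 * arcsin (sqrt (1 / 2 * ((cos (x / sqrt 2))\<^sup>2 + (sin (y / sqrt 2))\<^sup>2)))"

definition dil_cat_x :: "int \<Rightarrow> real \<Rightarrow> real \<Rightarrow> real" where
  "dil_cat_x k x y =
     (if k = 0 then arsinh (sqrt ((x / sqrt 2)\<^sup>2 + (y / sqrt 2)\<^sup>2))
      else arsinh (sqrt (((x / sqrt 2 + of_int k * pi)\<^sup>2 + (y / sqrt 2)\<^sup>2)
                         / (pi\<^sup>2 * (of_int k)\<^sup>2))))"

definition dil_cat_y :: "int \<Rightarrow> real \<Rightarrow> real \<Rightarrow> real" where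
  "dil_cat_y k x y =
     (if k = 0 then arsinh (sqrt ((x / sqrt 2)\<^sup>2 + (y / sqrt 2)\<^sup>2))
      else arsinh (sqrt (((x / sqrt 2)\<^sup>2 + (y / sqrt 2 + of_int k * pi)\<^sup>2)
                         / (pi\<^sup>2 * (of_int k)\<^sup>2))))"

definition sym_partial_prod :: "(int \<Rightarrow> real) \<Rightarrow> nat \<Rightarrow> real" where
  "sym_partial_prod a N = (\<Prod>k\<in>{- int N..int N}. a k)"

text \<open>The symmetric limit of a bi-infinite product. The value is meaningful only where the
  symmetric partial products converge; unlike with the usual convention for infinite products,
  the limit is allowed to be zero.\<close>

definition sym_infprod :: "(int \<Rightarrow> real) \<Rightarrow> real" where
  "sym_infprod a = lim (sym_partial_prod a)"

end

theory Submission
  imports Defs "HOL-Analysis.Gamma_Function"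
begin

text \<open>Raising \<open>N\<close> by one adjoins exactly the two indices \<open>Suc N\<close> and
  \<open>- Suc N\<close>, whose factors multiply to \<open>c (Suc N)\<close>. This turns a product
  over integers into one over positive naturals, the shape of Euler's product.\<close>

lemma sym_partial_prod_eq:
  assumes "\<And>k. k > 0 \<Longrightarrow> a k * a (- k) = c (nat k)"
  shows "sym_partial_prod a N = a 0 * (\<Prod>k = 1..N. c k)"
proof (induction N)
  case 0
  then show ?case by (simp add: sym_partial_prod_def)
next
  case (Suc N)
  have "{- int (Suc N)..int (Suc N)} =
      insert (int (Suc N)) (insert (- int (Suc N)) {- int N..int N})"
    by auto
  then have "sym_partial_prod a (Suc N) =
      a (int (Suc N)) * (a (- int (Suc N)) * sym_partial_prod a N)"
    by (simp add: sym_partial_prod_def del: of_nat_Suc)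
  moreover have "a (int (Suc N)) * a (- int (Suc N)) = c (Suc N)"
    using assms[of "int (Suc N)"] by (simp del: of_nat_Suc)
  ultimately show ?case
    using Suc.IH by (simp add: prod.nat_ivl_Suc' mult_ac del: of_nat_Suc)
qed

text \<open>Pairing the factors for \<open>k\<close> and \<open>- k\<close> gives the square of the factor
  \<open>1 - t\<^sup>2 / (\<pi>\<^sup>2 k\<^sup>2)\<close> in Euler's product for the sine.\<close>

lemma sym_partial_prod_tendsto_sin_squared:
  fixes t :: real
  assumes a: "\<And>k. a k = (if k = 0 then t\<^sup>2 else (t + of_int k * pi)\<^sup>2 / (pi\<^sup>2 * (of_int k)\<^sup>2))"
  shows "sym_partial_prod a \<longlonglongrightarrow> (sin t)\<^sup>2"
proof -
  define c where "c k = (1 - (t / pi)\<^sup>2 / (real k)\<^sup>2)\<^sup>2" for k :: nat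
  have "a k * a (- k) = c (nat k)" if "k > 0" for k
  proof -
    have "(t + of_int k * pi) * (t - of_int k * pi) = t\<^sup>2 - pi\<^sup>2 * (of_int k)\<^sup>2"
      by (simp add: power2_eq_square algebra_simps)
    then have "a k * a (- k) = ((t\<^sup>2 - pi\<^sup>2 * (of_int k)\<^sup>2) / (pi\<^sup>2 * (of_int k)\<^sup>2))\<^sup>2"
      using that by (simp add: a power_divide power2_eq_square mult_ac)
    also have "\<dots> = c (nat k)"
      \<comment> \<open>The base obtained is the negative of the one in \<open>c\<close>;
        \<open>power2_commute\<close> absorbs the sign under the square.\<close>
      using that unfolding c_def
      by (subst power2_commute[of 1]) (simp add: diff_divide_distrib power_divide)
    finally show ?thesis .
  qed
  \<comment> \<open>Euler's formula is stated for \<open>sin (pi * z)\<close>, hence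
    \<open>z = t / pi\<close>. The central factor \<open>t\<^sup>2\<close> is the square of the
    prefactor \<open>pi * (t / pi)\<close>, so each partial product is a perfect square, also when
    \<open>sin t = 0\<close>.\<close>
  then have "sym_partial_prod a = (\<lambda>N. (pi * (t / pi) * (\<Prod>k = 1..N. 1 - (t / pi)\<^sup>2 / (real k)\<^sup>2))\<^sup>2)"
    by (intro ext, subst sym_partial_prod_eq[where c = c])
      (simp_all add: a c_def power_mult_distrib prod_power_distrib)
  moreover have "(\<lambda>N. (pi * (t / pi) * (\<Prod>k = 1..N. 1 - (t / pi)\<^sup>2 / (real k)\<^sup>2))\<^sup>2)
      \<longlonglongrightarrow> (sin (pi * (t / pi)))\<^sup>2"
    by (intro tendsto_power sin_product_formula_real)
  ultimately show ?thesis
    by simp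
qed

theorem proposition2p5:
  fixes x y :: real
  shows "convergent (sym_partial_prod (\<lambda>k. (sinh (dil_cat_x k x 0))\<^sup>2))
       \<and> convergent (sym_partial_prod (\<lambda>k. (sinh (dil_cat_y k 0 y))\<^sup>2))
       \<and> 1 - sym_infprod (\<lambda>k. (sinh (dil_cat_x k x 0))\<^sup>2)
           + sym_infprod (\<lambda>k. (sinh (dil_cat_y k 0 y))\<^sup>2)
         = 2 * (sin (scherk_tower x y / 2))\<^sup>2"
proof -
  \<comment> \<open>On the axis, \<open>sinh\<close> undoes \<open>arsinh\<close> and the square
    undoes the root, leaving the factors above with \<open>t = x / sqrt 2\<close>.\<close>
  have X: "sym_partial_prod (\<lambda>k. (sinh (dil_cat_x k x 0))\<^sup>2) \<longlonglongrightarrow> (sin (x / sqrt 2))\<^sup>2"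
    by (rule sym_partial_prod_tendsto_sin_squared) (simp add: dil_cat_x_def power_divide)
  have Y: "sym_partial_prod (\<lambda>k. (sinh (dil_cat_y k 0 y))\<^sup>2) \<longlonglongrightarrow> (sin (y / sqrt 2))\<^sup>2"
    by (rule sym_partial_prod_tendsto_sin_squared) (simp add: dil_cat_y_def power_divide)
  define s where "s = 1 / 2 * ((cos (x / sqrt 2))\<^sup>2 + (sin (y / sqrt 2))\<^sup>2)"
  \<comment> \<open>As the mean of two numbers in [0, 1], \<open>s\<close> has its root in the
    domain of \<open>arcsin\<close> at every point, so \<open>sin\<close> cancels
    \<open>arcsin\<close>.\<close>
  have s: "0 \<le> s" "s \<le> 1"
    using abs_cos_le_one[of "x / sqrt 2"] abs_sin_le_one[of "y / sqrt 2"]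
    by (auto simp: s_def abs_square_le_1[symmetric])
  have "sin (scherk_tower x y / 2) = sqrt s"
    using s unfolding scherk_tower_def s_def[symmetric] by (simp add: order_trans[of "-1" 0])
  then have "2 * (sin (scherk_tower x y / 2))\<^sup>2 = 1 - (sin (x / sqrt 2))\<^sup>2 + (sin (y / sqrt 2))\<^sup>2"
    using s(1) by (simp add: s_def cos_squared_eq)
  with X Y show ?thesis
    by (auto simp: sym_infprod_def convergent_def limI)
qed

end
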